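(* Let $c>0$, let $\sigma_*\ge1$ be an integer, and let $T>0$. Let $c_0(t)$ be uniformly bounded and Lipschitz for $t\in[0,T]$. Then, for any initial condition $(\rho_0,\eta_0)\in D$, there is a solution on $[0,T]$ to the initial value problem $$\frac{d}{dt}\begin{pmatrix}\rho(t)\\ \eta(t)\end{pmatrix}=\bar F(\rho(t),\eta(t)),\qquad(\rho(0),\eta(0))=(\rho_0,\eta_0),$$ where $D$ and $\bar F$ (which depends on $t$ through $c_0(t)$) are as defined in the context.
   Context: $D=\{(\rho,\eta)\in\mathbb{R}^2: 0\le\rho\le\eta\}$. For $0<\rho<\eta$ put $p=\rho/\eta$ and $r=\rho^2/(\eta-\rho)$. Define $P_n:D\to\mathbb{R}$ by $$P_0(\rho,\eta)=\begin{cases}1,&0=\rho\le\eta,\\ p^r,&0<\rho<\eta,\\ e^{-\rho},&0<\rho=\eta,\end{cases}$$ and for integers $n>0$ $$P_n(\rho,\eta)=\begin{cases}0,&0=\rho\le\eta,\\ (1-p)^np^r\,\frac1{n!}\prod_{i=1}^n(n+r-i),&0<\rho<\eta,\\ \frac{\rho^n}{n!}e^{-\rho},&0<\rho=\eta.\end{cases}$$ Define $F=(F_1,F_2)^\top:D\to\mathbb{R}^2$ (depending also on $t$ through $c_0(t)$) by $$F_1(\rho,\eta)=c_0(t)-c+\frac{c}{\sigma_*}\sum_{i=0}^{\sigma_*-1}(\sigma_*-i)P_i(\rho,\eta),$$ $$F_2(\rho,\eta)=c_0(t)+c-\frac{c}{\sigma_*}\sum_{i=0}^{\sigma_*-1}(2\rho-2i+1)(\sigma_*-i)P_i(\rho,\eta).$$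 Define $\bar F:\mathbb{R}^2\to\mathbb{R}^2$ by $\bar F(\rho,\eta)=F(\mathrm{proj}_D(\rho,\eta))$, where $\mathrm{proj}_D$ is the Euclidean (2-norm) projection onto the closed convex set $D$. *)

theory Defs
  imports "HOL-Analysis.Analysis"
begin

definition D_dom :: "(real \<times> real) set" where
  "D_dom = {(\<rho>, \<eta>). 0 \<le> \<rho> \<and> \<rho> \<le> \<eta>}"

text \<open>
  Closedness, convexity and non-emptiness make \<^term>\<open>closest_point D_dom\<close> the (unique) Euclidean
  projection onto \<^term>\<open>D_dom\<close>; the distance on \<^typ>\<open>real \<times> real\<close> is the 2-norm distance.
\<close>

lemma closed_D_dom: "closed D_dom"
proof -
  have "D_dom = {x. 0 \<le> fst x} \<inter> {x. fst x \<le> snd x}"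
    by (auto simp: D_dom_def)
  moreover have "closed {x :: real \<times> real. 0 \<le> fst x}" "closed {x :: real \<times> real. fst x \<le> snd x}"
    by (intro closed_Collect_le continuous_intros)+
  ultimately show ?thesis
    by (metis closed_Int)
qed

lemma convex_D_dom: "convex D_dom"
  unfolding D_dom_def convex_def
  by (auto intro!: add_mono mult_left_mono)

lemma D_dom_nonempty: "D_dom \<noteq> {}"
proof -
  have "(0, 0) \<in> D_dom" by (simp add: D_dom_def)
  then show ?thesis by blast
qed

text \<open>
  The case distinctions below are meant for arguments in \<^term>\<open>D_dom\<close>, where the last branch is
  the diagonal \<open>0 < \<rho> = \<eta>\<close>. Values outside \<^term>\<open>D_dom\<close> are junk and are never
  used, since the functions are only evaluated after projecting onto \<^term>\<open>D_dom\<close>.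
\<close>

definition P :: "nat \<Rightarrow> real \<Rightarrow> real \<Rightarrow> real" where
  "P n \<rho> \<eta> =
    (let p = \<rho> / \<eta>; r = \<rho>\<^sup>2 / (\<eta> - \<rho>) in
     if n = 0 then
       (if \<rho> = 0 then 1
        else if \<rho> < \<eta> then p powr r
        else exp (- \<rho>))
     else
       (if \<rho> = 0 then 0
        else if \<rho> < \<eta> then
          (1 - p) ^ n * p powr r * (1 / fact n) * (\<Prod>i = 1..n. real n + r - real i)
        else \<rho> ^ n / fact n * exp (- \<rho>)))"

definition F1 :: "(real \<Rightarrow> real) \<Rightarrow> real \<Rightarrow> nat \<Rightarrow> real \<Rightarrow> real \<Rightarrow> real \<Rightarrow> real" where
  "F1 c0 c \<sigma> t \<rho> \<eta> =
     c0 t - c + c / real \<sigma> * (\<Sum>i<\<sigma>. (real \<sigma> - real i) * P i \<rho> \<eta>)"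

definition F2 :: "(real \<Rightarrow> real) \<Rightarrow> real \<Rightarrow> nat \<Rightarrow> real \<Rightarrow> real \<Rightarrow> real \<Rightarrow> real" where
  "F2 c0 c \<sigma> t \<rho> \<eta> =
     c0 t + c - c / real \<sigma> *
       (\<Sum>i<\<sigma>. (2 * \<rho> - 2 * real i + 1) * (real \<sigma> - real i) * P i \<rho> \<eta>)"

definition F :: "(real \<Rightarrow> real) \<Rightarrow> real \<Rightarrow> nat \<Rightarrow> real \<Rightarrow> real \<times> real \<Rightarrow> real \<times> real" where
  "F c0 c \<sigma> t = (\<lambda>(\<rho>, \<eta>). (F1 c0 c \<sigma> t \<rho> \<eta>, F2 c0 c \<sigma> t \<rho> \<eta>))"

definition Fbar :: "(real \<Rightarrow> real) \<Rightarrow> real \<Rightarrow> nat \<Rightarrow> real \<Rightarrow> real \<times> real \<Rightarrow> real \<times> real" where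
  "Fbar c0 c \<sigma> t x = F c0 c \<sigma> t (closest_point D_dom x)"

end

theory Submission
  imports Defs "HOL-Complex_Analysis.Great_Picard" "HOL-Real_Asymp.Real_Asymp"
begin

text \<open>
  In the coordinates \<open>(\<rho>, p)\<close> with \<open>p = \<rho> / \<eta>\<close> every \<open>P n\<close> becomes a function that is continuous on
  \<open>\<rho> \<ge> 0\<close>, \<open>0 \<le> p \<le> 1\<close> and constant in \<open>p\<close> on the edge \<open>\<rho> = 0\<close>; hence \<open>P n\<close> is continuous on
  \<^term>\<open>D_dom\<close>, the corner \<open>(0, 0)\<close> included. It is also bounded, so the projected field is continuous
  and of linear growth. Peano's theorem follows from Tonelli's delayed equations and the
  Arzela--Ascoli theorem for bounded fields; a field of linear growth is truncated outside a ball
  that, by a Gronwall estimate, no solution leaves.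
\<close>

subsection \<open>Peano's existence theorem\<close>

text \<open>
  Tonelli's delay makes the iteration stationary: since the integrand at \<open>s\<close> only looks at time
  \<open>s - h\<close>, the \<open>k\<close>-th iterate already solves the delayed integral equation up to time \<open>k * h\<close>.
  For \<open>t < 0\<close> the integral is over the empty set, so all iterates equal \<open>x0\<close> there.
\<close>

fun delayed_picard :: "(real \<Rightarrow> 'a::euclidean_space \<Rightarrow> 'a) \<Rightarrow> 'a \<Rightarrow> real \<Rightarrow> nat \<Rightarrow> real \<Rightarrow> 'a" where
  "delayed_picard f x0 h 0 t = x0"
| "delayed_picard f x0 h (Suc k) t = x0 + integral {0..t} (\<lambda>s. f s (delayed_picard f x0 h k (s - h)))"

section \<open>Regularity of Tonelli's delayed iterates\<close>

lemma continuous_on_delayed_integrand: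
  fixes f :: "real \<Rightarrow> 'a::euclidean_space \<Rightarrow> 'a"
  assumes f: "continuous_on ({0..T} \<times> UNIV) (\<lambda>(t, x). f t x)"
    and g: "continuous_on {..T} g" and "0 \<le> h"
  shows "continuous_on {0..T} (\<lambda>s. f s (g (s - h)))"
proof -
  have "continuous_on {0..T} (\<lambda>s. (s, g (s - h)))"
    using \<open>0 \<le> h\<close> by (intro continuous_intros continuous_on_compose2[OF g]) auto
  then have "continuous_on {0..T} (\<lambda>s. (\<lambda>(t, x). f t x) (s, g (s - h)))"
    by (intro continuous_on_compose2[OF f]) auto
  then show ?thesis by simp
qed

text \<open>The integrand is bounded by \<open>M\<close> whatever \<open>h\<close> and
  \<open>k\<close> are, so the constant is uniform; this is the equicontinuity behind the
  compactness argument. The domain extends below 0 because the delayed argument \<open>s - h\<close>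
  does.\<close>

lemma delayed_picard_lipschitz:
  fixes f :: "real \<Rightarrow> 'a::euclidean_space \<Rightarrow> 'a"
  assumes f: "continuous_on ({0..T} \<times> UNIV) (\<lambda>(t, x). f t x)"
    and M: "\<And>t x. t \<in> {0..T} \<Longrightarrow> norm (f t x) \<le> M"
    and "0 \<le> M" "0 \<le> h"
  shows "M-lipschitz_on {..T} (delayed_picard f x0 h k)"
proof (induction k)
  case 0
  then show ?case using \<open>0 \<le> M\<close> by (auto simp: lipschitz_on_def)
next
  case (Suc k)
  let ?g = "\<lambda>s. f s (delayed_picard f x0 h k (s - h))"
  have g: "continuous_on {0..T} ?g"
    using Suc lipschitz_on_continuous_on assms by (intro continuous_on_delayed_integrand) blast+
  have le: "norm (integral {0..t} ?g - integral {0..s} ?g) \<le> M * (t - s)" if "s \<le> t" "t \<le> T" for s t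
  proof (cases "0 \<le> t")
    case True
    \<comment> \<open>For \<open>s < 0\<close> both integrals vanish, so the constant past needs no
      separate estimate.\<close>
    have "integral {0..s} ?g = integral {0..max 0 s} ?g" by (cases "s < 0") auto
    moreover have "integral {0..max 0 s} ?g + integral {max 0 s..t} ?g = integral {0..t} ?g"
      using True that
      by (intro Henstock_Kurzweil_Integration.integral_combine integrable_continuous_real
          continuous_on_subset[OF g]) auto
    ultimately have "integral {0..t} ?g - integral {0..s} ?g = integral {max 0 s..t} ?g"
      by (simp add: diff_eq_eq add.commute)
    moreover have "norm (integral {max 0 s..t} ?g) \<le> M * (t - max 0 s)"
      using True that by (intro integral_bound continuous_on_subset[OF g] M) auto
    moreover have "M * (t - max 0 s) \<le> M * (t - s)"
      using \<open>0 \<le> M\<close> by (intro mult_left_mono) auto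
    ultimately show ?thesis by simp
  next
    case False
    then show ?thesis using that \<open>0 \<le> M\<close> by simp
  qed
  show ?case
  proof (rule lipschitz_onI)
    fix s t assume "s \<in> {..T}" "t \<in> {..T}"
    then show "dist (delayed_picard f x0 h (Suc k) s) (delayed_picard f x0 h (Suc k) t) \<le> M * dist s t"
      using le[of s t] le[of t s]
      by (cases "s \<le> t") (auto simp: dist_norm norm_minus_commute)
  qed fact
qed

text \<open>For \<open>s \<le> t \<le> (k + 1) * h\<close> the delayed time satisfies
  \<open>s - h \<le> k * h\<close>, so the induction hypothesis identifies the integrands. For
  \<open>k = 0\<close> the integral runs over an empty or one-point set.\<close>

lemma delayed_picard_stable:
  assumes "t \<le> real k * h"
  shows "delayed_picard f x0 h (Suc k) t = delayed_picard f x0 h k t"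
  using assms
proof (induction k arbitrary: t)
  case 0
  then show ?case by (cases "t = 0") auto
next
  case (Suc k)
  have "integral {0..t} (\<lambda>s. f s (delayed_picard f x0 h (Suc k) (s - h)))
      = integral {0..t} (\<lambda>s. f s (delayed_picard f x0 h k (s - h)))"
    using Suc.prems by (intro integral_cong arg_cong2[where f = f] refl Suc.IH) (auto simp: algebra_simps)
  then show ?case by simp
qed

text \<open>The delayed solutions share a bound and a Lipschitz constant, so a subsequence converges
  uniformly. As the delays tend to 0, the limit solves the undelayed integral equation, which is
  then differentiated.\<close>

lemma peano_bounded:
  fixes f :: "real \<Rightarrow> 'a::euclidean_space \<Rightarrow> 'a"
  assumes "0 < T"
    and f: "continuous_on ({0..T} \<times> UNIV) (\<lambda>(t, x). f t x)"
    and M: "\<And>t x. t \<in> {0..T} \<Longrightarrow> norm (f t x) \<le> M"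
  obtains x where "x 0 = x0"
    "\<And>t. t \<in> {0..T} \<Longrightarrow> (x has_vector_derivative f t (x t)) (at t within {0..T})"
proof -
  have "0 \<le> M" using order_trans[OF norm_ge_zero M[of 0 x0]] \<open>0 < T\<close> by simp
  \<comment> \<open>\<open>Suc n\<close> delays of this length fill \<open>{0..T}\<close>, so
    iterate \<open>Suc n\<close> solves the delayed equation exactly up to time
    \<open>T\<close>.\<close>
  define h where "h n = T / real (Suc n)" for n
  define \<phi> where "\<phi> n = delayed_picard f x0 (h n) (Suc n)" for n
  have h: "0 \<le> h n" for n using \<open>0 < T\<close> by (simp add: h_def)
  have lip: "M-lipschitz_on {..T} (\<phi> n)" for n
    unfolding \<phi>_def using assms \<open>0 \<le> M\<close> h by (intro delayed_picard_lipschitz) auto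
  have eq: "\<phi> n t = x0 + integral {0..t} (\<lambda>s. f s (\<phi> n (s - h n)))" if "t \<le> T" for n t
  proof -
    have "t \<le> real (Suc n) * h n" using that by (simp add: h_def)
    from delayed_picard_stable[OF this, of f x0] show ?thesis by (simp only: \<phi>_def delayed_picard.simps(2))
  qed
  have le: "norm (\<phi> n s - \<phi> n t) \<le> M * \<bar>s - t\<bar>" if "s \<le> T" "t \<le> T" for n s t
    using lipschitz_onD[OF lip, of s t n] that by (simp add: dist_norm)
  define B where "B = norm x0 + M * T"
  have start: "\<phi> n t = x0" if "t \<le> 0" for n t
    using that eq[of t n] \<open>0 < T\<close> by (cases "t = 0") auto
  have B: "norm (\<phi> n t) \<le> B" if "t \<le> T" for n t
  proof (cases "t \<le> 0")
    case True
    then show ?thesis using start \<open>0 \<le> M\<close> \<open>0 < T\<close> by (simp add: B_def)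
  next
    case False
    have "norm (\<phi> n t) \<le> norm x0 + norm (\<phi> n t - \<phi> n 0)"
      using start[of 0 n] norm_triangle_sub[of "\<phi> n t" x0] by simp
    also have "\<dots> \<le> norm x0 + M * t" using le[of t 0 n] False that \<open>0 < T\<close> by simp
    also have "\<dots> \<le> B" unfolding B_def using that \<open>0 \<le> M\<close> by (simp add: mult_left_mono)
    finally show ?thesis .
  qed
  obtain x k where x: "continuous_on {0..T} x" and k: "strict_mono (k :: nat \<Rightarrow> nat)"
    and lim: "\<And>e. 0 < e \<Longrightarrow> \<exists>N. \<forall>n t. n \<ge> N \<and> t \<in> {0..T} \<longrightarrow> norm (\<phi> (k n) t - x t) < e"
  proof (rule Arzela_Ascoli[of "{0..T}" \<phi> B])
    fix t e :: real assume t: "t \<in> {0..T}" and "0 < e"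
    \<comment> \<open>Dividing by \<open>M + 1\<close> rather than \<open>M\<close> covers
      \<open>M = 0\<close>.\<close>
    have "norm (\<phi> n t - \<phi> n s) < e" if "s \<in> {0..T}" "norm (t - s) < e / (M + 1)" for n s
    proof -
      have "norm (\<phi> n t - \<phi> n s) \<le> (M + 1) * \<bar>t - s\<bar>"
        using le[of t s n] t that by (simp add: algebra_simps)
      also have "\<dots> < e" using that \<open>0 \<le> M\<close> by (simp add: field_simps)
      finally show ?thesis .
    qed
    then show "\<exists>d>0. \<forall>n s. s \<in> {0..T} \<and> norm (t - s) < d \<longrightarrow> norm (\<phi> n t - \<phi> n s) < e"
      using \<open>0 \<le> M\<close> \<open>0 < e\<close> by (intro exI[of _ "e / (M + 1)"]) auto
  qed (use B in auto)
  have ulim: "uniform_limit {0..T} (\<lambda>n. \<phi> (k n)) x sequentially"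
    using lim by (fastforce simp: uniform_limit_iff eventually_sequentially dist_norm)
  \<comment> \<open>The delay moves values by at most \<open>M * h (k n)\<close>, which tends to 0,
    so the limit stays the same.\<close>
  have "uniform_limit {0..T} (\<lambda>n s. \<phi> (k n) (s - h (k n))) x sequentially"
  proof (rule uniform_limitI)
    fix e :: real assume "0 < e"
    have "(\<lambda>n. M * h n) \<longlonglongrightarrow> 0" unfolding h_def by real_asymp
    from LIMSEQ_subseq_LIMSEQ[OF this k] have "\<forall>\<^sub>F n in sequentially. M * h (k n) < e / 2"
      using \<open>0 < e\<close> by (intro order_tendstoD) (auto simp: o_def)
    moreover have "\<forall>\<^sub>F n in sequentially. \<forall>s\<in>{0..T}. dist (\<phi> (k n) s) (x s) < e / 2"
      using uniform_limitD[OF ulim, of "e / 2"] \<open>0 < e\<close> by simp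
    ultimately show "\<forall>\<^sub>F n in sequentially. \<forall>s\<in>{0..T}. dist (\<phi> (k n) (s - h (k n))) (x s) < e"
    proof eventually_elim
      case (elim n)
      show ?case
      proof
        fix s assume s: "s \<in> {0..T}"
        have "dist (\<phi> (k n) (s - h (k n))) (\<phi> (k n) s) \<le> M * h (k n)"
          using le[of "s - h (k n)" s "k n"] s h[of "k n"] by (simp add: dist_norm)
        moreover have "dist (\<phi> (k n) s) (x s) < e / 2" using elim s by blast
        ultimately show "dist (\<phi> (k n) (s - h (k n))) (x s) < e"
          using elim(1) dist_triangle[of "\<phi> (k n) (s - h (k n))" "x s" "\<phi> (k n) s"] by linarith
      qed
    qed
  qed
  then have pairs: "uniform_limit {0..T} (\<lambda>n s. (s, \<phi> (k n) (s - h (k n)))) (\<lambda>s. (s, x s)) sequentially"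
    by (simp add: uniform_limit_iff dist_Pair_Pair)
  \<comment> \<open>\<open>f\<close> is merely continuous; confining the iterates and their limit to
    the ball of radius \<open>B\<close> makes it uniformly continuous there, so the integrands
    converge uniformly.\<close>
  have "norm (x t) \<le> B" if "t \<in> {0..T}" for t
    using tendsto_uniform_limitI[OF ulim that] B that
    by (intro Lim_norm_ubound[where f = "\<lambda>n. \<phi> (k n) t"]) auto
  moreover have "uniformly_continuous_on ({0..T} \<times> cball 0 B) (\<lambda>(t, x). f t x)"
    by (intro compact_uniformly_continuous continuous_on_subset[OF f] compact_Times) auto
  moreover have "norm (\<phi> (k n) (s - h (k n))) \<le> B" if "s \<in> {0..T}" for n s
    using that h[of "k n"] by (intro B) simp
  ultimately have
    "uniform_limit {0..T} (\<lambda>n s. (\<lambda>(t, x). f t x) (s, \<phi> (k n) (s - h (k n))))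
       (\<lambda>s. (\<lambda>(t, x). f t x) (s, x s)) sequentially"
    by (intro uniform_limit_compose_uniformly_continuous_on[OF pairs, of "{0..T} \<times> cball 0 B"])
      (auto intro!: closed_Times)
  then have flim: "uniform_limit {0..T} (\<lambda>n s. f s (\<phi> (k n) (s - h (k n)))) (\<lambda>s. f s (x s)) sequentially"
    by simp
  have inteq: "x t = x0 + integral {0..t} (\<lambda>s. f s (x s))" if t: "t \<in> {0..T}" for t
  proof -
    let ?g = "\<lambda>n s. f s (\<phi> (k n) (s - h (k n)))"
    obtain I J where I: "\<And>n. (?g n has_integral I n) {0..t}"
      and J: "((\<lambda>s. f s (x s)) has_integral J) {0..t}" and lim: "(I \<longlongrightarrow> J) sequentially"
    proof (rule uniform_limit_integral)
      show "uniform_limit {0..t} ?g (\<lambda>s. f s (x s)) sequentially"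
        using flim by (rule uniform_limit_on_subset) (use t in auto)
      show "continuous_on {0..t} (?g n)" for n
        by (rule continuous_on_subset[OF
              continuous_on_delayed_integrand[OF f lipschitz_on_continuous_on[OF lip] h]])
          (use t in auto)
    qed auto
    have "I = (\<lambda>n. \<phi> (k n) t - x0)"
    proof
      show "I n = \<phi> (k n) t - x0" for n
        using integral_unique[OF I[of n]] eq[of t "k n"] t by simp
    qed
    moreover have "(\<lambda>n. \<phi> (k n) t - x0) \<longlonglongrightarrow> x t - x0"
      by (intro tendsto_intros tendsto_uniform_limitI[OF ulim t])
    ultimately have "x t - x0 = J" using lim LIMSEQ_unique by blast
    then show ?thesis using integral_unique[OF J] by (simp add: algebra_simps)
  qed
  have "continuous_on {0..T} (\<lambda>s. (\<lambda>(t, x). f t x) (s, x s))"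
    by (intro continuous_on_compose2[OF f] continuous_intros x) auto
  then have cont: "continuous_on {0..T} (\<lambda>s. f s (x s))" by simp
  show thesis
  proof (rule that)
    show "x 0 = x0" using inteq[of 0] \<open>0 < T\<close> by simp
    fix t assume t: "t \<in> {0..T}"
    have "((\<lambda>t. x0 + integral {0..t} (\<lambda>s. f s (x s))) has_vector_derivative f t (x t)) (at t within {0..T})"
      using has_vector_derivative_add[OF has_vector_derivative_const integral_has_vector_derivative[OF cont t]]
      by simp
    then show "(x has_vector_derivative f t (x t)) (at t within {0..T})"
      by (rule has_vector_derivative_transform[OF t inteq, rotated])
  qed
qed

section \<open>A priori bound and fields of linear growth\<close>

text \<open>Gronwall's argument with integrating factor \<open>exp (- 3 * K * s)\<close>. The
  squared norm, unlike the norm, is differentiable at 0.\<close>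

lemma norm_bound_of_linear_growth:
  fixes x :: "real \<Rightarrow> 'a::real_inner"
  assumes x: "\<And>t. t \<in> {0..T} \<Longrightarrow> (x has_vector_derivative x' t) (at t within {0..T})"
    and K: "\<And>t. t \<in> {0..T} \<Longrightarrow> norm (x' t) \<le> K * (1 + norm (x t))"
    and t: "t \<in> {0..T}" and "0 \<le> K"
  shows "1 + (norm (x t))\<^sup>2 \<le> (1 + (norm (x 0))\<^sup>2) * exp (3 * K * t)"
proof -
  define u where "u s = (1 + x s \<bullet> x s) * exp (- 3 * K * s)" for s
  have du: "(u has_real_derivative (2 * (x s \<bullet> x' s) - 3 * K * (1 + x s \<bullet> x s)) * exp (- 3 * K * s))
      (at s within {0..T})" if "s \<in> {0..T}" for s
  proof -
    have "((\<lambda>s. x s \<bullet> x s) has_real_derivative 2 * (x s \<bullet> x' s)) (at s within {0..T})"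
      using has_derivative_inner[OF x[OF that, unfolded has_vector_derivative_def]
          x[OF that, unfolded has_vector_derivative_def]]
      unfolding has_field_derivative_def
      by (rule has_derivative_eq_rhs) (auto simp: inner_commute)
    then show ?thesis unfolding u_def
      by (auto intro!: derivative_eq_intros simp: algebra_simps)
  qed
  have "u t \<le> u 0"
  proof (rule DERIV_nonpos_imp_decreasing_open[of 0 t u])
    show "0 \<le> t" using t by simp
    show "continuous_on {0..t} u"
      by (rule continuous_on_subset[OF DERIV_continuous_on[OF du]]) (use t in auto)
    fix s assume "0 < s" "s < t"
    then have s: "s \<in> {0..T}" "at s within {0..T} = at s" using t
      by (auto intro!: at_within_interior)
    have "2 * (x s \<bullet> x' s) \<le> 2 * (norm (x s) * norm (x' s))"
      using norm_cauchy_schwarz by auto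
    also have "\<dots> \<le> 2 * (norm (x s) * (K * (1 + norm (x s))))"
      using K[OF s(1)] by (intro mult_left_mono) auto
    also have "\<dots> = K * (2 * norm (x s) + 2 * (norm (x s))\<^sup>2)"
      by (simp add: algebra_simps power2_eq_square)
    \<comment> \<open>The factor 3 comes from
      \<open>2 * norm (x s) \<le> 1 + (norm (x s))\<^sup>2\<close>.\<close>
    also have "\<dots> \<le> K * (3 * (1 + (norm (x s))\<^sup>2))"
      using \<open>0 \<le> K\<close> zero_le_power2[of "norm (x s) - 1"]
      by (intro mult_left_mono) (auto simp: power2_diff)
    finally have "2 * (x s \<bullet> x' s) - 3 * K * (1 + x s \<bullet> x s) \<le> 0"
      by (simp add: power2_norm_eq_inner algebra_simps)
    then show "\<exists>y. (u has_real_derivative y) (at s) \<and> y \<le> 0"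
      using du[OF s(1)] s(2) by (metis exp_ge_zero mult_nonpos_nonneg)
  qed
  then show ?thesis
    by (simp add: u_def power2_norm_eq_inner exp_minus field_simps)
qed

text \<open>Projecting onto a ball does not increase norms, so the truncated field keeps the growth
  constant \<open>K\<close>. Hence \<open>R\<close>, the a priori bound at time \<open>T\<close>,
  also confines the truncated solution, and the truncation is never felt.\<close>

lemma peano_linear_growth:
  fixes f :: "real \<Rightarrow> 'a::euclidean_space \<Rightarrow> 'a"
  assumes "0 < T"
    and f: "continuous_on ({0..T} \<times> UNIV) (\<lambda>(t, x). f t x)"
    and K: "\<And>t x. t \<in> {0..T} \<Longrightarrow> norm (f t x) \<le> K * (1 + norm x)" and "0 \<le> K"
  obtains x where "x 0 = x0"
    "\<And>t. t \<in> {0..T} \<Longrightarrow> (x has_vector_derivative f t (x t)) (at t within {0..T})"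
proof -
  define R where "R = sqrt ((1 + (norm x0)\<^sup>2) * exp (3 * K * T))"
  define \<pi> where "\<pi> = closest_point (cball (0::'a) R)"
  have "0 \<le> R" by (simp add: R_def)
  then have ball: "closed (cball (0::'a) R)" "convex (cball (0::'a) R)" "cball (0::'a) R \<noteq> {}" by auto
  have \<pi>R: "norm (\<pi> y) \<le> R" for y
    using closest_point_in_set[OF ball(1,3), of y] by (simp add: \<pi>_def)
  have \<pi>_le: "norm (\<pi> y) \<le> norm y" for y
    using closest_point_lipschitz[OF ball(2,1,3), of y 0] \<open>0 \<le> R\<close>
    by (simp add: \<pi>_def closest_point_self dist_norm)
  obtain x where x0: "x 0 = x0"
    and x: "\<And>t. t \<in> {0..T} \<Longrightarrow> (x has_vector_derivative f t (\<pi> (x t))) (at t within {0..T})"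
  proof (rule peano_bounded[OF \<open>0 < T\<close>])
    have "continuous_on ({0..T} \<times> UNIV) (\<lambda>z. (\<lambda>(t, x). f t x) (fst z, \<pi> (snd z)))"
      unfolding \<pi>_def
      by (intro continuous_on_compose2[OF f] continuous_intros
          continuous_on_compose2[OF continuous_on_closest_point[OF ball(2,1,3)]]) auto
    then show "continuous_on ({0..T} \<times> UNIV) (\<lambda>(t, y). f t (\<pi> y))"
      by (simp add: case_prod_beta)
    show "norm (f t (\<pi> y)) \<le> K * (1 + R)" if "t \<in> {0..T}" for t y
      using K[OF that, of "\<pi> y"] mult_left_mono[OF _ \<open>0 \<le> K\<close>, of "1 + norm (\<pi> y)" "1 + R"] \<pi>R[of y]
      by linarith
  qed blast
  have "\<pi> (x t) = x t" if t: "t \<in> {0..T}" for t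
  proof -
    have "norm (f s (\<pi> (x s))) \<le> K * (1 + norm (x s))" if "s \<in> {0..T}" for s
      using K[OF that, of "\<pi> (x s)"] mult_left_mono[OF _ \<open>0 \<le> K\<close>, of "1 + norm (\<pi> (x s))" "1 + norm (x s)"]
        \<pi>_le[of "x s"] by linarith
    from norm_bound_of_linear_growth[OF x this t \<open>0 \<le> K\<close>]
    have "(norm (x t))\<^sup>2 \<le> (1 + (norm x0)\<^sup>2) * exp (3 * K * t)" by (simp add: x0)
    also have "\<dots> \<le> (1 + (norm x0)\<^sup>2) * exp (3 * K * T)"
      using t \<open>0 \<le> K\<close> by (intro mult_left_mono) (auto intro: mult_left_mono)
    finally have "norm (x t) \<le> R" by (simp add: R_def real_le_rsqrt)
    then show ?thesis by (simp add: \<pi>_def closest_point_self)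
  qed
  with x x0 show thesis by (intro that[of x]) auto
qed

subsection \<open>Continuity and growth of the field\<close>

text \<open>
  The value \<open>1\<close> is the limit at \<open>p = 1\<close>; at \<open>p = 0\<close> the convention \<open>ln 0 = 0\<close> gives the limit \<open>0\<close>.
\<close>

definition rate :: "real \<Rightarrow> real" where
  "rate p = (if p = 1 then 1 else - p * ln p / (1 - p))"

lemma continuous_on_rate: "continuous_on {0..1} rate"
  unfolding continuous_on_def
proof
  fix p :: real assume p: "p \<in> {0..1}"
  consider "p = 0" | "p = 1" | "0 < p" "p < 1" using p by fastforce
  then show "(rate \<longlongrightarrow> rate p) (at p within {0..1})"
  proof cases
    case 1
    have "((\<lambda>p::real. - p * ln p / (1 - p)) \<longlongrightarrow> 0) (at_right 0)" by real_asymp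
    moreover have "\<forall>\<^sub>F p in at_right 0. - p * ln p / (1 - p) = rate p"
      using eventually_at_right_real[of 0 "1::real", OF zero_less_one]
      by eventually_elim (auto simp: rate_def)
    ultimately show ?thesis
      using 1 by (auto simp: at_within_Icc_at_right rate_def elim: Lim_transform_eventually)
  next
    case 2
    have "((\<lambda>p::real. - p * ln p / (1 - p)) \<longlongrightarrow> 1) (at_left 1)" by real_asymp
    moreover have "\<forall>\<^sub>F p in at_left 1. - p * ln p / (1 - p) = rate p"
      using eventually_at_left_real[of 0 "1::real", OF zero_less_one]
      by eventually_elim (auto simp: rate_def)
    ultimately show ?thesis
      using 2 by (auto simp: at_within_Icc_at_left rate_def elim: Lim_transform_eventually)
  next
    case 3
    have "((\<lambda>p::real. - p * ln p / (1 - p)) \<longlongrightarrow> rate p) (at p)"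
      using 3 by (auto intro!: tendsto_eq_intros simp: rate_def)
    moreover have "\<forall>\<^sub>F q in at p. - q * ln q / (1 - q) = rate q"
      using 3 by (intro eventually_at_in_open[THEN eventually_mono, of "{0<..<1}"]) (auto simp: rate_def)
    ultimately show ?thesis
      by (auto intro: tendsto_within_subset[OF Lim_transform_eventually])
  qed
qed

text \<open>Inside the interval this is \<open>ln p \<le> p - 1\<close>. It lets
  \<open>exp (- \<rho> * rate p)\<close> absorb a growth of \<open>exp (\<rho> * p)\<close> in
  \<open>P_bound\<close>.\<close>

lemma rate_ge: "p \<le> rate p" if "p \<in> {0..1}"
proof (cases "p = 0 \<or> p = 1")
  case False
  with that have "0 < p" "p < 1" by auto
  then have "p * (1 - p) \<le> p * (- ln p)"
    using ln_le_minus_one[of p] by (intro mult_left_mono) auto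
  then show ?thesis using \<open>p < 1\<close> by (simp add: rate_def field_simps)
qed (auto simp: rate_def)

text \<open>
  With \<open>p = \<rho> / \<eta>\<close> and \<open>r = \<rho>\<^sup>2 / (\<eta> - \<rho>)\<close> one has \<open>(1 - p) * r = \<rho> * p\<close>, so distributing
  \<open>(1 - p) ^ n\<close> over the product and writing \<open>p\<close> to the power \<open>r\<close> as an exponential removes
  the singularity of \<open>r\<close> on the diagonal.
\<close>

definition P_lift :: "nat \<Rightarrow> real \<Rightarrow> real \<Rightarrow> real" where
  "P_lift n \<rho> p = exp (- \<rho> * rate p) / fact n * (\<Prod>i=1..n. (1 - p) * (real n - real i) + \<rho> * p)"

lemma P_eq_P_lift:
  assumes "0 \<le> \<rho>" "\<rho> \<le> \<eta>"
  shows "P n \<rho> \<eta> = P_lift n \<rho> (\<rho> / \<eta>)"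
proof -
  consider "\<rho> = 0" | "0 < \<rho>" "\<rho> = \<eta>" | "0 < \<rho>" "\<rho> < \<eta>" using assms by fastforce
  then show ?thesis
  proof cases
    case 1
    \<comment> \<open>The factor \<open>i = n\<close> kills the product. Since
      \<open>0 / 0 = 0\<close>, the corner is included.\<close>
    have "\<exists>i\<in>{1..n}. real n - real i = 0" if "n \<noteq> 0" using that by auto
    then show ?thesis using 1 by (auto simp: P_def P_lift_def)
  next
    case 2
    then show ?thesis by (simp add: P_def P_lift_def rate_def)
  next
    case 3
    define p r where "p = \<rho> / \<eta>" and "r = \<rho>\<^sup>2 / (\<eta> - \<rho>)"
    have "(1 - p) * r = (\<eta> - \<rho>) / \<eta> * (\<rho>\<^sup>2 / (\<eta> - \<rho>))" using 3 by (simp add: p_def r_def field_simps)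
    also have "\<dots> = \<rho> * p" using 3 by (simp add: p_def power2_eq_square)
    finally have pr: "(1 - p) * r = \<rho> * p" .
    have p: "0 < p" "p < 1" using 3 by (auto simp: p_def)
    then have "r = \<rho> * p / (1 - p)" using pr by (simp add: field_simps)
    then have "p powr r = exp (- \<rho> * rate p)" using p by (simp add: powr_def rate_def)
    moreover have "(1 - p) * (real n + r - real i) = (1 - p) * (real n - real i) + \<rho> * p" for i
      using pr by (simp add: algebra_simps)
    then have "(\<Prod>i=1..n. (1 - p) * (real n - real i) + \<rho> * p)
        = (\<Prod>i=1..n. (1 - p) * (real n + r - real i))"
      by (simp only:)
    then have "(\<Prod>i=1..n. (1 - p) * (real n - real i) + \<rho> * p)
        = (1 - p) ^ n * (\<Prod>i=1..n. real n + r - real i)"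
      by (simp add: prod.distrib)
    ultimately show ?thesis
      using 3 unfolding P_def Let_def p_def[symmetric] r_def[symmetric] P_lift_def by simp
  qed
qed

lemma continuous_on_P_lift: "continuous_on ({0..} \<times> {0..1}) (\<lambda>(\<rho>, p). P_lift n \<rho> p)"
  unfolding P_lift_def case_prod_beta
  by (intro continuous_intros continuous_on_compose2[OF continuous_on_rate]) auto

text \<open>Supplies the constancy in \<open>p\<close> along the edge \<open>\<rho> = 0\<close> that
  continuity at the corner needs.\<close>

lemma P_lift_zero: "P_lift n 0 p = (if n = 0 then 1 else 0)"
proof (cases "n = 0")
  case False
  then have "(\<Prod>i=1..n. (1 - p) * (real n - real i) + 0 * p) = 0"
    by (intro prod_zero bexI[of _ n]) auto
  with False show ?thesis by (simp add: P_lift_def)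
qed (simp add: P_lift_def)

text \<open>
  The quotient \<open>\<rho> / \<eta>\<close> has no limit at the corner \<open>(0, 0)\<close>; there one uses that \<open>q 0\<close> is constant
  and that \<open>q\<close> is uniformly continuous on a compact square.
\<close>

lemma continuous_on_D_dom_quotient:
  fixes q :: "real \<Rightarrow> real \<Rightarrow> real"
  assumes q: "continuous_on ({0..} \<times> {0..1}) (\<lambda>(\<rho>, p). q \<rho> p)"
    and q0: "\<And>p. p \<in> {0..1} \<Longrightarrow> q 0 p = q 0 0"
  shows "continuous_on D_dom (\<lambda>(\<rho>, \<eta>). q \<rho> (\<rho> / \<eta>))"
  unfolding continuous_on_eq_continuous_within
proof
  have quot: "x / y \<in> {0..1}" if "(x, y) \<in> D_dom" for x y :: real
    using that by (auto simp: D_dom_def divide_le_eq_1)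
  fix z assume z: "z \<in> D_dom"
  show "continuous (at z within D_dom) (\<lambda>(\<rho>, \<eta>). q \<rho> (\<rho> / \<eta>))"
  proof (cases "snd z = 0")
    case False
    define U where "U = D_dom \<inter> {w. snd w > 0}"
    have zU: "z \<in> U" using z False by (auto simp: U_def D_dom_def)
    have "continuous_on U (\<lambda>w. (\<lambda>(\<rho>, p). q \<rho> p) (fst w, fst w / snd w))"
      by (rule continuous_on_compose2[OF q])
        (auto intro!: continuous_intros simp: U_def D_dom_def)
    then have "continuous (at z within U) (\<lambda>(\<rho>, \<eta>). q \<rho> (\<rho> / \<eta>))"
      using zU unfolding continuous_on_eq_continuous_within case_prod_beta fst_conv snd_conv by blast
    moreover have "at z within U = at z within D_dom"
    proof (rule at_within_nhd)
      show "open {w :: real \<times> real. 0 < snd w}" by (intro open_Collect_less continuous_intros)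
    qed (use zU in \<open>auto simp: U_def\<close>)
    ultimately show ?thesis by simp
  next
    case True
    with z have z0: "z = (0, 0)" by (auto simp: D_dom_def prod_eq_iff)
    have "uniformly_continuous_on ({0..1} \<times> {0..1}) (\<lambda>(\<rho>, p). q \<rho> p)"
      by (intro compact_uniformly_continuous continuous_on_subset[OF q] compact_Times) auto
    note uc = this[unfolded uniformly_continuous_on_def]
    show ?thesis
      unfolding continuous_within_eps_delta
    proof (intro allI impI)
      fix e :: real assume "0 < e"
      then obtain d where "0 < d"
        and d: "\<And>a b. a \<in> {0..1} \<times> {0..1} \<Longrightarrow> b \<in> {0..1} \<times> {0..1} \<Longrightarrow> dist b a < d \<Longrightarrow>
          dist ((\<lambda>(\<rho>, p). q \<rho> p) b) ((\<lambda>(\<rho>, p). q \<rho> p) a) < e"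
        using uc by meson
      \<comment> \<open>The points \<open>(x, x / y)\<close> and \<open>(0, x / y)\<close> share
        their second coordinate and are only \<open>x\<close> apart, however the quotient behaves.
        The cap 1 keeps \<open>x\<close> in the unit square.\<close>
      have "dist (q x (x / y)) (q 0 0) < e" if xy: "(x, y) \<in> D_dom" "dist (x, y) (0, 0) < min d 1" for x y
      proof -
        have "\<bar>x\<bar> \<le> dist (x, y) (0, 0)" using dist_fst_le[of "(x, y)" "(0, 0)"] by (simp add: dist_real_def)
        moreover have "0 \<le> x" using xy by (auto simp: D_dom_def)
        ultimately have "x < d" "x \<in> {0..1}" using xy by auto
        then have "dist (q x (x / y)) (q 0 (x / y)) < e"
          using d[of "(0, x / y)" "(x, x / y)"] quot[OF xy(1)] \<open>0 \<le> x\<close> by (simp add: dist_Pair_Pair)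
        then show ?thesis using q0[OF quot[OF xy(1)]] by simp
      qed
      then show "\<exists>d>0. \<forall>w\<in>D_dom. dist w z < d \<longrightarrow>
          dist (case w of (\<rho>, \<eta>) \<Rightarrow> q \<rho> (\<rho> / \<eta>)) (case z of (\<rho>, \<eta>) \<Rightarrow> q \<rho> (\<rho> / \<eta>)) < e"
        using \<open>0 < d\<close> z0 by (intro exI[of _ "min d 1"]) auto
    qed
  qed
qed

lemma continuous_on_P: "continuous_on D_dom (\<lambda>(\<rho>, \<eta>). P n \<rho> \<eta>)"
proof -
  have "continuous_on D_dom (\<lambda>(\<rho>, \<eta>). P_lift n \<rho> (\<rho> / \<eta>))"
    by (rule continuous_on_D_dom_quotient[OF continuous_on_P_lift]) (simp add: P_lift_zero)
  then show ?thesis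
    by (rule continuous_on_cong[THEN iffD1, rotated -1]) (auto simp: P_eq_P_lift D_dom_def)
qed

text \<open>Each factor is at most \<open>n + \<rho> * p\<close>, hence at most
  \<open>n * exp (\<rho> * p / n)\<close>, so the product is at most
  \<open>n ^ n * exp (\<rho> * p)\<close>; by \<open>rate_ge\<close> the exponential prefactor
  cancels the growth. For \<open>n = 0\<close> the bound reads \<open>0 ^ 0 = 1\<close>.\<close>

lemma P_bound:
  assumes "(\<rho>, \<eta>) \<in> D_dom"
  shows "\<bar>P n \<rho> \<eta>\<bar> \<le> real n ^ n"
proof -
  define p where "p = \<rho> / \<eta>"
  have \<rho>: "0 \<le> \<rho>" "\<rho> \<le> \<eta>" and p: "0 \<le> p" "p \<le> 1"
    using assms by (auto simp: D_dom_def p_def divide_le_eq_1)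
  have factor: "0 \<le> (1 - p) * (real n - real i) + \<rho> * p \<and>
      (1 - p) * (real n - real i) + \<rho> * p \<le> real n * exp (\<rho> * p / real n)" if "i \<in> {1..n}" for i
  proof -
    have "(1 - p) * (real n - real i) \<le> 1 * real n"
      using p that by (intro mult_mono) auto
    moreover have "real n * (1 + \<rho> * p / real n) = real n + \<rho> * p"
      using that by (simp add: distrib_left)
    ultimately have "(1 - p) * (real n - real i) + \<rho> * p \<le> real n * (1 + \<rho> * p / real n)"
      by simp
    also have "\<dots> \<le> real n * exp (\<rho> * p / real n)"
      by (intro mult_left_mono exp_ge_add_one_self) auto
    finally show ?thesis using p \<rho> that by simp
  qed
  let ?prod = "\<Prod>i=1..n. (1 - p) * (real n - real i) + \<rho> * p"
  have nonneg: "0 \<le> ?prod" using factor by (intro prod_nonneg) auto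
  have "?prod \<le> (\<Prod>i=1..n. real n * exp (\<rho> * p / real n))"
    using factor by (intro prod_mono) auto
  also have "\<dots> \<le> real n ^ n * exp (\<rho> * p)"
    using p \<rho> by (cases "n = 0") (simp_all add: power_mult_distrib flip: exp_of_nat_mult)
  finally have "?prod \<le> real n ^ n * exp (\<rho> * p)" .
  moreover have "exp (- \<rho> * rate p) / fact n \<le> exp (- (\<rho> * p)) / 1"
    using rate_ge[of p] p \<rho> by (intro frac_le) (auto simp: mult_left_mono fact_ge_1)
  ultimately have "P_lift n \<rho> p \<le> exp (- (\<rho> * p)) / 1 * (real n ^ n * exp (\<rho> * p))"
    unfolding P_lift_def using nonneg by (intro mult_mono) auto
  also have "\<dots> = real n ^ n" by (simp add: exp_minus field_simps)
  finally have "P_lift n \<rho> p \<le> real n ^ n" .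
  moreover have "0 \<le> P_lift n \<rho> p" unfolding P_lift_def using nonneg by auto
  ultimately show ?thesis using P_eq_P_lift[OF \<rho>] by (simp add: p_def)
qed

section \<open>Continuity and linear growth of the projected field\<close>

lemma closest_point_D_dom: "closest_point D_dom x \<in> D_dom"
  by (rule closest_point_in_set[OF closed_D_dom D_dom_nonempty])

text \<open>The projection is nonexpansive and fixes the origin.\<close>

lemma norm_closest_point_D_dom_le: "norm (closest_point D_dom x) \<le> norm x"
proof -
  have "0 \<in> D_dom" by (simp add: D_dom_def zero_prod_def)
  then show ?thesis
    using closest_point_lipschitz[OF convex_D_dom closed_D_dom D_dom_nonempty, of x 0]
    by (simp add: closest_point_self dist_norm)
qed

lemma continuous_on_Fbar:
  assumes "continuous_on S c0"
  shows "continuous_on (S \<times> UNIV) (\<lambda>(t, x). Fbar c0 c \<sigma> t x)"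
proof -
  let ?\<pi> = "closest_point D_dom"
  have \<pi>: "continuous_on (S \<times> UNIV) (\<lambda>z. ?\<pi> (snd z))"
    by (intro continuous_on_compose2[OF continuous_on_closest_point[OF convex_D_dom closed_D_dom D_dom_nonempty]]
        continuous_intros) auto
  have P: "continuous_on (S \<times> UNIV) (\<lambda>z. P i (fst (?\<pi> (snd z))) (snd (?\<pi> (snd z))))" for i
    using continuous_on_compose2[OF continuous_on_P[of i] \<pi>] closest_point_D_dom
    by (simp add: case_prod_beta image_subset_iff)
  have c: "continuous_on (S \<times> UNIV) (\<lambda>z. c0 (fst z))"
    by (intro continuous_on_compose2[OF assms] continuous_intros) auto
  show ?thesis
    unfolding Fbar_def F_def F1_def F2_def case_prod_beta
    by (intro continuous_intros P c \<pi>)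
qed

text \<open>With every \<open>P i\<close> bounded, \<open>F1\<close> is bounded, while the weights
  in \<open>F2\<close> grow linearly in \<open>\<rho>\<close>, which is at most
  \<open>norm x\<close>.\<close>

lemma Fbar_linear_growth:
  assumes "bounded (c0 ` S)"
  obtains K where "0 \<le> K" "\<And>t x. t \<in> S \<Longrightarrow> norm (Fbar c0 c \<sigma> t x) \<le> K * (1 + norm x)"
proof -
  obtain B where B: "0 < B" "\<And>t. t \<in> S \<Longrightarrow> \<bar>c0 t\<bar> \<le> B"
    using assms unfolding bounded_pos by auto
  define A where "A = \<bar>c\<bar> / real \<sigma> * (\<Sum>i<\<sigma>. real \<sigma> * real i ^ i)"
  have "0 \<le> A" by (simp add: A_def sum_nonneg)
  let ?K = "2 * (B + \<bar>c\<bar>) + (2 * real \<sigma> + 4) * A"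
  show thesis
  proof (rule that)
    show "0 \<le> ?K" using B \<open>0 \<le> A\<close> by simp
    fix t and x :: "real \<times> real" assume t: "t \<in> S"
    obtain \<rho> \<eta> where \<pi>: "closest_point D_dom x = (\<rho>, \<eta>)" by fastforce
    have D: "(\<rho>, \<eta>) \<in> D_dom" using closest_point_D_dom[of x] \<pi> by simp
    then have "0 \<le> \<rho>" by (simp add: D_dom_def)
    have "\<rho> \<le> norm x"
      using norm_fst_le[of \<rho> \<eta>] norm_closest_point_D_dom_le[of x] \<pi> \<open>0 \<le> \<rho>\<close> by simp
    \<comment> \<open>One estimate for both sums: \<open>w\<close> is 1 for \<open>F1\<close> and
      \<open>2 * \<rho> - 2 * i + 1\<close> for \<open>F2\<close>.\<close>
    have weighted: "\<bar>c / real \<sigma> * (\<Sum>i<\<sigma>. w i * (real \<sigma> - real i) * P i \<rho> \<eta>)\<bar> \<le> W * A"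
      if w: "\<And>i. i < \<sigma> \<Longrightarrow> \<bar>w i\<bar> \<le> W" for w W
    proof -
      have "\<bar>w i * (real \<sigma> - real i) * P i \<rho> \<eta>\<bar> \<le> W * (real \<sigma> * real i ^ i)" if "i < \<sigma>" for i
      proof -
        have "0 \<le> W" using w[OF that] by linarith
        then have "\<bar>w i\<bar> * (\<bar>real \<sigma> - real i\<bar> * \<bar>P i \<rho> \<eta>\<bar>) \<le> W * (real \<sigma> * real i ^ i)"
          using that w[OF that] P_bound[OF D, of i] by (intro mult_mono) auto
        then show ?thesis by (simp add: abs_mult mult.assoc)
      qed
      then have "\<bar>\<Sum>i<\<sigma>. w i * (real \<sigma> - real i) * P i \<rho> \<eta>\<bar> \<le> (\<Sum>i<\<sigma>. W * (real \<sigma> * real i ^ i))"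
        by (intro order_trans[OF sum_abs] sum_mono) auto
      then have "\<bar>c\<bar> / real \<sigma> * \<bar>\<Sum>i<\<sigma>. w i * (real \<sigma> - real i) * P i \<rho> \<eta>\<bar>
          \<le> \<bar>c\<bar> / real \<sigma> * (\<Sum>i<\<sigma>. W * (real \<sigma> * real i ^ i))"
        by (intro mult_left_mono) auto
      then show ?thesis by (simp add: abs_mult A_def sum_distrib_left[symmetric] mult_ac)
    qed
    have "\<bar>c / real \<sigma> * (\<Sum>i<\<sigma>. (real \<sigma> - real i) * P i \<rho> \<eta>)\<bar> \<le> A"
      using weighted[of "\<lambda>_. 1" 1] by simp
    then have "\<bar>F1 c0 c \<sigma> t \<rho> \<eta>\<bar> \<le> B + \<bar>c\<bar> + A"
      using B(2)[OF t] unfolding F1_def by linarith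
    moreover have "\<bar>2 * \<rho> - 2 * real i + 1\<bar> \<le> 2 * \<rho> + 2 * real \<sigma> + 1" if "i < \<sigma>" for i
      using that \<open>0 \<le> \<rho>\<close> by (auto simp: abs_le_iff)
    from weighted[of "\<lambda>i. 2 * \<rho> - 2 * real i + 1", OF this]
    have "\<bar>F2 c0 c \<sigma> t \<rho> \<eta>\<bar> \<le> B + \<bar>c\<bar> + (2 * \<rho> + 2 * real \<sigma> + 1) * A"
      using B(2)[OF t] unfolding F2_def by linarith
    moreover have "norm (Fbar c0 c \<sigma> t x) \<le> \<bar>F1 c0 c \<sigma> t \<rho> \<eta>\<bar> + \<bar>F2 c0 c \<sigma> t \<rho> \<eta>\<bar>"
      using norm_Pair_le[of "F1 c0 c \<sigma> t \<rho> \<eta>" "F2 c0 c \<sigma> t \<rho> \<eta>"] by (simp add: Fbar_def F_def \<pi>)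
    \<comment> \<open>After expansion the claim is linear in these products, so only their signs and
      the comparison of \<open>\<rho>\<close> with \<open>norm x\<close> remain to be
      supplied.\<close>
    moreover have "\<rho> * A \<le> norm x * A" "0 \<le> norm x * A" "0 \<le> norm x * (real \<sigma> * A)"
      "0 \<le> norm x * (B + \<bar>c\<bar>)"
      using \<open>\<rho> \<le> norm x\<close> \<open>0 \<le> A\<close> B(1) by (auto intro: mult_right_mono)
    ultimately show "norm (Fbar c0 c \<sigma> t x) \<le> ?K * (1 + norm x)"
      using \<open>0 \<le> A\<close> by (simp only: algebra_simps)
  qed
qed

theorem theorem7:
  fixes c T \<rho>0 \<eta>0 :: real and \<sigma> :: nat and c0 :: "real \<Rightarrow> real"
  assumes "c > 0" and "\<sigma> \<ge> 1" and "T > 0"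
    and "bounded (c0 ` {0..T})"
    and "\<exists>L. L-lipschitz_on {0..T} c0"
    and "(\<rho>0, \<eta>0) \<in> D_dom"
  shows "\<exists>\<rho> \<eta> :: real \<Rightarrow> real.
           (\<rho> 0, \<eta> 0) = (\<rho>0, \<eta>0) \<and>
           (\<forall>t\<in>{0..T}. ((\<lambda>s. (\<rho> s, \<eta> s)) has_vector_derivative
                            Fbar c0 c \<sigma> t (\<rho> t, \<eta> t)) (at t within {0..T}))"
proof -
  have "continuous_on {0..T} c0" using assms(5) lipschitz_on_continuous_on by blast
  then have cont: "continuous_on ({0..T} \<times> UNIV) (\<lambda>(t, x). Fbar c0 c \<sigma> t x)"
    by (rule continuous_on_Fbar)
  obtain K where "0 \<le> K"
    and K: "\<And>t x. t \<in> {0..T} \<Longrightarrow> norm (Fbar c0 c \<sigma> t x) \<le> K * (1 + norm x)"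
    by (rule Fbar_linear_growth[OF assms(4)]) blast
  obtain x where x0: "x 0 = (\<rho>0, \<eta>0)"
    and x: "\<And>t. t \<in> {0..T} \<Longrightarrow> (x has_vector_derivative Fbar c0 c \<sigma> t (x t)) (at t within {0..T})"
    by (rule peano_linear_growth[OF assms(3) cont K \<open>0 \<le> K\<close>, where ?x0.0 = "(\<rho>0, \<eta>0)"]) blast+
  show ?thesis
    using x0 x by (intro exI[of _ "\<lambda>t. fst (x t)"] exI[of _ "\<lambda>t. snd (x t)"]) simp
qed

end
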